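(* There is no universal constant $c>0$ such that the myopic greedy algorithm satisfies $\mathbb E[\mathrm{Rev}^{\mathrm{Greedy}}]\ge c\,\mathrm{OPT}_{\mathrm{on}}$ for all instances of the online allocation model in the full-compatibility setting.
   Context: Model. An instance consists of products $\mathcal I=\{1,\dots,m\}$, capacities $b_i\in\mathbb Z_+$, base rewards $r_i\ge 0$, bonus functions $f_i:\mathbb Z_+\to\mathbb R_+$ that are nonnegative and nondecreasing with $f_i(0)=0$, a horizon of $T$ periods and arrival probabilities $p_1,\dots,p_T\in[0,1]$. In period $t$ a customer arrives with probability $p_t$, independently across periods. Each arriving customer must be immediately and irrevocably assigned to a product with remaining capacity or rejected; every customer may be assigned to every product (full compatibility). The $k$-th sale of product $i$ yields reward $r_i+f_i(k)$. An online algorithm $\pi$ knows all parameters of the instance, but its decision in each period depends only on the arrivals observed so far, its past decisions and internal randomization independent of the arrivals. $\mathrm{Rev}^\pi$ is its random total reward and $\mathrm{OPT}_{\mathrm{on}}=\sup_\pi\mathbb E[\mathrm{Rev}^\pi]$ over all online algorithms. Myopic greedy: given current allocation $\boldsymbol x$ ($x_j$ customers already assigned to product $j$), assign an arriving customer to some $i\in\arg\max_{j:\,x_j<b_j}\{r_j+f_j(x_j+1)\}$; if all products are sold out, reject the customer. *)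

theory Defs
  imports "HOL-Probability.Probability"
begin

record alloc_instance =
  num_products :: nat
  capacity :: "nat \<Rightarrow> nat"
  base_reward :: "nat \<Rightarrow> real"
  bonus :: "nat \<Rightarrow> nat \<Rightarrow> real"
  horizon :: nat
  arrival_prob :: "nat \<Rightarrow> real"

text \<open>Products are \<open>1, \<dots>, m\<close> and periods are \<open>1, \<dots>, T\<close>; the values of the functions in an
  instance outside these ranges are never used.\<close>

definition products :: "alloc_instance \<Rightarrow> nat set" where
  "products I = {1..num_products I}"

definition valid_instance :: "alloc_instance \<Rightarrow> bool" where
  "valid_instance I \<longleftrightarrow>
     (\<forall>i\<in>products I. base_reward I i \<ge> 0 \<and> bonus I i 0 = 0 \<and>
        (\<forall>k. bonus I i k \<ge> 0) \<and> mono (bonus I i)) \<and>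
     (\<forall>t\<in>{1..horizon I}. 0 \<le> arrival_prob I t \<and> arrival_prob I t \<le> 1)"

definition arrivals :: "alloc_instance \<Rightarrow> (nat \<Rightarrow> bool) pmf" where
  "arrivals I = Pi_pmf {1..horizon I} False (\<lambda>t. bernoulli_pmf (arrival_prob I t))"

text \<open>A decision is \<open>Some i\<close> (the customer is assigned to product \<open>i\<close>) or \<open>None\<close> (no
  assignment: the customer is rejected, or nobody arrived).\<close>

definition sold :: "nat option list \<Rightarrow> nat \<Rightarrow> nat" where
  "sold ds i = count_list ds (Some i)"

definition available :: "alloc_instance \<Rightarrow> nat option list \<Rightarrow> nat \<Rightarrow> bool" where
  "available I ds i \<longleftrightarrow> i \<in> products I \<and> sold ds i < capacity I i"

definition reward :: "alloc_instance \<Rightarrow> nat option list \<Rightarrow> real" where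
  "reward I ds = (\<Sum>i\<in>products I. \<Sum>k=1..sold ds i. base_reward I i + bonus I i k)"

text \<open>The internal randomization is a random element of an arbitrary probability space
  \<open>seed\<close> over the reals (any standard Borel space embeds there). The decision in a period
  is a function of the seed, of the arrival indicators up to and including that period, and of the
  decisions made in the earlier periods. Dependence on the instance is expressed by choosing
  the algorithm after the instance.\<close>

record algorithm =
  seed :: "real measure"
  decide :: "real \<Rightarrow> bool list \<Rightarrow> nat option list \<Rightarrow> nat option"

primrec decisions :: "algorithm \<Rightarrow> real \<Rightarrow> (nat \<Rightarrow> bool) \<Rightarrow> nat \<Rightarrow> nat option list" where
  "decisions A \<omega> a 0 = []"
| "decisions A \<omega> a (Suc t) =
     decisions A \<omega> a t @ [decide A \<omega> (map a [1..<Suc (Suc t)]) (decisions A \<omega> a t)]"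

text \<open>The decision taken in period \<open>t + 1\<close>:\<close>

abbreviation next_decision :: "algorithm \<Rightarrow> real \<Rightarrow> (nat \<Rightarrow> bool) \<Rightarrow> nat \<Rightarrow> nat option" where
  "next_decision A \<omega> a t \<equiv> decide A \<omega> (map a [1..<Suc (Suc t)]) (decisions A \<omega> a t)"

definition online_algorithm :: "alloc_instance \<Rightarrow> algorithm \<Rightarrow> bool" where
  "online_algorithm I A \<longleftrightarrow>
     prob_space (seed A) \<and>
     (\<forall>as ds. (\<lambda>\<omega>. decide A \<omega> as ds) \<in> measurable (seed A) (count_space UNIV)) \<and>
     (\<forall>\<omega>\<in>space (seed A). \<forall>a. \<forall>t<horizon I. \<forall>i.
        next_decision A \<omega> a t = Some i \<longrightarrow> a (Suc t) \<and> available I (decisions A \<omega> a t) i)"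

text \<open>The product measure makes the internal randomization independent of the arrivals.\<close>

definition expected_revenue :: "alloc_instance \<Rightarrow> algorithm \<Rightarrow> real" where
  "expected_revenue I A =
     (\<integral>(\<omega>, a). reward I (decisions A \<omega> a (horizon I)) \<partial>(seed A \<Otimes>\<^sub>M measure_pmf (arrivals I)))"

definition opt_online :: "alloc_instance \<Rightarrow> real" where
  "opt_online I = (SUP A\<in>{A. online_algorithm I A}. expected_revenue I A)"

text \<open>Ties in the argmax may be broken arbitrarily, possibly depending on the history and at random.\<close>

definition myopic_greedy :: "alloc_instance \<Rightarrow> algorithm \<Rightarrow> bool" where
  "myopic_greedy I A \<longleftrightarrow>
     online_algorithm I A \<and>
     (\<forall>\<omega>\<in>space (seed A). \<forall>a. \<forall>t<horizon I. a (Suc t) \<longrightarrow>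
        (let ds = decisions A \<omega> a t in
         case next_decision A \<omega> a t of
           None \<Rightarrow> \<not> (\<exists>j. available I ds j)
         | Some i \<Rightarrow> is_arg_max (\<lambda>j. base_reward I j + bonus I j (sold ds j + 1))
                       (available I ds) i))"

text \<open>The remaining facts show that the notions above are well defined: revenues are integrable
  random variables, the supremum in \<open>opt_online\<close> is over a nonempty bounded set, and
  every instance has a greedy algorithm.\<close>

lemma length_decisions [simp]: "length (decisions A \<omega> a t) = t"
  by (induction t) auto

lemma decisions_cong:
  "(\<And>s. s \<in> {1..t} \<Longrightarrow> a s = a' s) \<Longrightarrow> decisions A \<omega> a t = decisions A \<omega> a' t"
proof (induction t)
  case (Suc t)
  have "map a [1..<Suc (Suc t)] = map a' [1..<Suc (Suc t)]"
    by (rule map_cong) (use Suc.prems in auto)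
  moreover have "decisions A \<omega> a t = decisions A \<omega> a' t"
    by (rule Suc.IH) (use Suc.prems in auto)
  ultimately show ?case by (simp only: decisions.simps)
qed simp

lemma measurable_decisions:
  assumes "online_algorithm I A"
  shows "(\<lambda>\<omega>. decisions A \<omega> a t) \<in> measurable (seed A) (count_space UNIV)"
proof (induction t)
  case (Suc t)
  have "(\<lambda>\<omega>. (\<lambda>ds \<omega>. ds @ [decide A \<omega> (map a [1..<Suc (Suc t)]) ds]) (decisions A \<omega> a t) \<omega>)
          \<in> measurable (seed A) (count_space UNIV)"
  proof (rule measurable_compose_countable[OF _ Suc.IH])
    fix ds
    have "(\<lambda>\<omega>. decide A \<omega> (map a [1..<Suc (Suc t)]) ds) \<in> measurable (seed A) (count_space UNIV)"
      using assms by (simp add: online_algorithm_def)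
    then show "(\<lambda>\<omega>. ds @ [decide A \<omega> (map a [1..<Suc (Suc t)]) ds])
                 \<in> measurable (seed A) (count_space UNIV)"
      by (rule measurable_compose) simp
  qed
  then show ?case by simp
qed simp

lemma measurable_revenue:
  assumes "online_algorithm I A"
  shows "(\<lambda>(\<omega>, a). reward I (decisions A \<omega> a (horizon I)))
           \<in> borel_measurable (seed A \<Otimes>\<^sub>M measure_pmf (arrivals I))"
proof -
  let ?T = "horizon I" and ?N = "seed A \<Otimes>\<^sub>M measure_pmf (arrivals I)"
  let ?h = "\<lambda>a. map a [1..<Suc ?T]"
  let ?a = "\<lambda>as t. as ! (t - 1)"
  have eq: "decisions A \<omega> a ?T = decisions A \<omega> (?a (?h a)) ?T" for \<omega> a
    by (rule decisions_cong) (auto simp del: upt_Suc)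
  have "(\<lambda>x. (\<lambda>as x. reward I (decisions A (fst x) (?a as) ?T)) (?h (snd x)) x)
          \<in> borel_measurable ?N"
  proof (rule measurable_compose_countable[where g = "\<lambda>x. ?h (snd x)"
              and f = "\<lambda>as x. reward I (decisions A (fst x) (?a as) ?T)"])
    fix as :: "bool list"
    have "(\<lambda>x. decisions A (fst x) (?a as) ?T) \<in> measurable ?N (count_space UNIV)"
      using measurable_compose[OF measurable_fst measurable_decisions[OF assms]] by simp
    then show "(\<lambda>x. reward I (decisions A (fst x) (?a as) ?T)) \<in> borel_measurable ?N"
      by (rule measurable_compose[where g = "reward I"]) simp
    have "snd \<in> measurable ?N (measure_pmf (arrivals I))"
      by (rule measurable_snd)
    then show "(\<lambda>x. ?h (snd x)) \<in> measurable ?N (count_space UNIV)"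
      by (rule measurable_compose[where g = ?h]) simp
  qed
  then show ?thesis using eq by (simp add: case_prod_beta del: upt_Suc)
qed

lemma sold_le_length: "sold ds i \<le> length ds"
  by (simp add: sold_def count_le_length)

definition reward_bound :: "alloc_instance \<Rightarrow> real" where
  "reward_bound I =
     (\<Sum>i\<in>products I. \<Sum>k=1..horizon I. base_reward I i + bonus I i k)"

lemma reward_bounds:
  assumes "valid_instance I"
  shows "0 \<le> reward I (decisions A \<omega> a (horizon I))"
    and "reward I (decisions A \<omega> a (horizon I)) \<le> reward_bound I"
proof -
  have nn: "0 \<le> base_reward I i + bonus I i k" if "i \<in> products I" for i k
    using assms that by (simp add: valid_instance_def)
  then show "0 \<le> reward I (decisions A \<omega> a (horizon I))"
    unfolding reward_def by (intro sum_nonneg) auto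
  have "sold (decisions A \<omega> a (horizon I)) i \<le> horizon I" for i
    using sold_le_length[of "decisions A \<omega> a (horizon I)" i] by simp
  then show "reward I (decisions A \<omega> a (horizon I)) \<le> reward_bound I"
    unfolding reward_def reward_bound_def using nn
    by (intro sum_mono sum_mono2) auto
qed

lemma prob_space_run:
  assumes "online_algorithm I A"
  shows "prob_space (seed A \<Otimes>\<^sub>M measure_pmf (arrivals I))"
proof -
  interpret S: prob_space "seed A" using assms by (simp add: online_algorithm_def)
  interpret P: pair_prob_space "seed A" "measure_pmf (arrivals I)" ..
  show ?thesis by (rule P.prob_space_axioms)
qed

lemma integrable_revenue:
  assumes "valid_instance I" "online_algorithm I A"
  shows "integrable (seed A \<Otimes>\<^sub>M measure_pmf (arrivals I))
           (\<lambda>(\<omega>, a). reward I (decisions A \<omega> a (horizon I)))"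
proof -
  interpret prob_space "seed A \<Otimes>\<^sub>M measure_pmf (arrivals I)"
    by (rule prob_space_run[OF assms(2)])
  show ?thesis
    by (rule integrable_const_bound[where B = "reward_bound I"])
       (use reward_bounds[OF assms(1)] measurable_revenue[OF assms(2)] in auto)
qed

lemma bdd_above_expected_revenue:
  assumes "valid_instance I"
  shows "bdd_above (expected_revenue I ` {A. online_algorithm I A})"
proof (rule bdd_aboveI2)
  fix A assume "A \<in> {A. online_algorithm I A}"
  then have A: "online_algorithm I A" by simp
  interpret prob_space "seed A \<Otimes>\<^sub>M measure_pmf (arrivals I)"
    by (rule prob_space_run[OF A])
  show "expected_revenue I A \<le> reward_bound I"
    unfolding expected_revenue_def
    by (rule integral_le_const[OF integrable_revenue[OF assms A]])
       (use reward_bounds[OF assms] in auto)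
qed

lemma ex_myopic_greedy: "\<exists>A. myopic_greedy I A"
proof -
  let ?g = "\<lambda>ds j. base_reward I j + bonus I j (sold ds j + 1)"
  define d where "d as ds =
    (if last as \<and> (\<exists>j. available I ds j)
     then Some (SOME i. is_arg_max (?g ds) (available I ds) i) else None)" for as ds
  define A where "A = \<lparr>seed = return borel (0::real), decide = (\<lambda>_. d)\<rparr>"
  have ex: "\<exists>i. is_arg_max (?g ds) (available I ds) i" if "\<exists>j. available I ds j" for ds
  proof -
    let ?S = "{j. available I ds j}"
    have fin: "finite ?S"
      by (rule finite_subset[of _ "products I"]) (auto simp: available_def products_def)
    have "?g ds ` ?S \<noteq> {}" using that by auto
    then have "Max (?g ds ` ?S) \<in> ?g ds ` ?S"
      using fin by (intro Max_in) auto
    then obtain i where i: "i \<in> ?S" "?g ds i = Max (?g ds ` ?S)" by auto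
    have "?g ds j \<le> ?g ds i" if "j \<in> ?S" for j
      unfolding i(2) using fin that by (intro Max_ge) auto
    with i(1) show ?thesis by (auto simp: is_arg_max_linorder)
  qed
  have am: "is_arg_max (?g ds) (available I ds) i" "last as" if "d as ds = Some i" for as ds i
    using that someI_ex[OF ex[of ds]] by (auto simp: d_def split: if_splits)
  have nn: "\<not> (\<exists>j. available I ds j)" if "d as ds = None" "last as" for as ds
    using that by (auto simp: d_def split: if_splits)
  have on: "online_algorithm I A"
    unfolding online_algorithm_def
  proof (intro conjI ballI allI impI)
    show "prob_space (seed A)" by (simp add: A_def prob_space_return)
    show "(\<lambda>\<omega>. decide A \<omega> as ds) \<in> measurable (seed A) (count_space UNIV)" for as ds
      by (simp add: A_def)
  next
    fix \<omega> a t i assume "next_decision A \<omega> a t = Some i"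
    then have *: "d (map a [1..<Suc (Suc t)]) (decisions A \<omega> a t) = Some i"
      by (simp add: A_def)
    from am(2)[OF *] show "a (Suc t)" by simp
    from am(1)[OF *] show "available I (decisions A \<omega> a t) i" by (simp add: is_arg_max_def)
  qed
  have "myopic_greedy I A"
    unfolding myopic_greedy_def Let_def
  proof (intro conjI ballI allI impI on)
    fix \<omega> a t assume a: "a (Suc t)"
    have dec: "next_decision A \<omega> a t = d (map a [1..<Suc (Suc t)]) (decisions A \<omega> a t)"
      by (simp add: A_def)
    show "case next_decision A \<omega> a t of
            None \<Rightarrow> \<not> (\<exists>j. available I (decisions A \<omega> a t) j)
          | Some i \<Rightarrow> is_arg_max (?g (decisions A \<omega> a t)) (available I (decisions A \<omega> a t)) i"
      unfolding dec using am(1) nn a by (auto split: option.split)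
  qed
  then show ?thesis ..
qed

end

theory Submission imports Defs begin

text \<open>Two customers arrive with certainty. Product 1 pays 1 per sale, while product 2 pays
  nothing for its first sale and \<open>M\<close> for its second. Greedy never starts selling product 2 and
  earns at most 2; assigning both customers to product 2 earns \<open>M\<close>, which is arbitrary.\<close>

definition delayed_bonus_instance :: "real \<Rightarrow> alloc_instance" where
  "delayed_bonus_instance M =
     \<lparr>num_products = 2, capacity = (\<lambda>_. 2),
      base_reward = (\<lambda>i. if i = 1 then 1 else 0),
      bonus = (\<lambda>i k. if i = 2 \<and> k \<ge> 2 then M else 0),
      horizon = 2, arrival_prob = (\<lambda>_. 1)\<rparr>"

text \<open>The seed is a point mass, so the algorithm is deterministic. \<open>last as\<close> is
  the arrival indicator of the current period; with the availability test it makes the algorithm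
  feasible for every \<open>I\<close> and \<open>i\<close>.\<close>

definition commit_algorithm :: "alloc_instance \<Rightarrow> nat \<Rightarrow> algorithm" where
  "commit_algorithm I i =
     \<lparr>seed = return borel 0,
      decide = (\<lambda>_ as ds. if last as \<and> available I ds i then Some i else None)\<rparr>"

lemma delayed_bonus_instance_simps [simp]:
  "capacity (delayed_bonus_instance M) i = 2"
  "base_reward (delayed_bonus_instance M) i = (if i = 1 then 1 else 0)"
  "bonus (delayed_bonus_instance M) i k = (if i = 2 \<and> k \<ge> 2 then M else 0)"
  "horizon (delayed_bonus_instance M) = 2"
  "arrival_prob (delayed_bonus_instance M) t = 1"
  by (simp_all add: delayed_bonus_instance_def)

lemma products_delayed_bonus_instance [simp]: "products (delayed_bonus_instance M) = {1, 2}"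
  by (auto simp: products_def delayed_bonus_instance_def)

lemma valid_delayed_bonus_instance: "M \<ge> 0 \<Longrightarrow> valid_instance (delayed_bonus_instance M)"
  by (auto simp: valid_instance_def mono_def)

lemma reward_delayed_bonus_instance:
  "reward (delayed_bonus_instance M) ds =
     real (sold ds 1) + (\<Sum>k=1..sold ds 2. if k \<ge> 2 then M else 0)"
  by (simp add: reward_def)

text \<open>The first sale of product 2 is worth 0, strictly less than the 1 offered by product 1,
  so no tie-breaking rule can select product 2.\<close>

lemma greedy_next_decision:
  assumes greedy: "myopic_greedy (delayed_bonus_instance M) A" and \<omega>: "\<omega> \<in> space (seed A)"
    and t: "t < 2" and unsold: "sold (decisions A \<omega> a t) 2 = 0"
  shows "next_decision A \<omega> a t \<noteq> Some 2"
proof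
  assume two: "next_decision A \<omega> a t = Some 2"
  let ?I = "delayed_bonus_instance M" and ?ds = "decisions A \<omega> a t"
  have "online_algorithm ?I A" using greedy by (simp add: myopic_greedy_def)
  \<comment> \<open>The greedy condition constrains only periods with an arrival; feasibility
    supplies the arrival, since a sale takes place.\<close>
  then have "a (Suc t)"
    using \<omega> t two unfolding online_algorithm_def by (metis delayed_bonus_instance_simps(4))
  then have max: "is_arg_max (\<lambda>j. base_reward ?I j + bonus ?I j (sold ?ds j + 1)) (available ?I ?ds) 2"
    using greedy \<omega> t two unfolding myopic_greedy_def Let_def
    by (auto split: option.splits simp del: upt_Suc) 
  \<comment> \<open>Fewer than two decisions precede this one and the capacity is 2, so product 1
    cannot be sold out.\<close>
  have "available ?I ?ds 1"
    using sold_le_length[of ?ds 1] t by (simp add: available_def)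
  with max unsold show False by (auto simp: is_arg_max_linorder)
qed

lemma greedy_never_sells_delayed_bonus:
  assumes "myopic_greedy (delayed_bonus_instance M) A" "\<omega> \<in> space (seed A)" "t \<le> 2"
  shows "sold (decisions A \<omega> a t) 2 = 0"
  using assms(3)
proof (induction t)
  case (Suc t)
  then have "sold (decisions A \<omega> a t) 2 = 0" by simp
  with greedy_next_decision[OF assms(1,2) _ this] Suc.prems show ?case
    by (simp add: sold_def del: upt_Suc)
qed (simp add: sold_def)

text \<open>The bound holds on every sample path: product 2 contributes nothing, and product 1 earns
  at most 1 in each of the two periods.\<close>

lemma greedy_revenue_le:
  assumes "M \<ge> 0" and greedy: "myopic_greedy (delayed_bonus_instance M) A"
  shows "expected_revenue (delayed_bonus_instance M) A \<le> 2"
proof -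
  let ?I = "delayed_bonus_instance M"
  have on: "online_algorithm ?I A" using greedy by (simp add: myopic_greedy_def)
  interpret prob_space "seed A \<Otimes>\<^sub>M measure_pmf (arrivals ?I)"
    by (rule prob_space_run[OF on])
  have "reward ?I (decisions A \<omega> a 2) \<le> 2" if "\<omega> \<in> space (seed A)" for \<omega> a
    using greedy_never_sells_delayed_bonus[OF greedy that, of 2 a]
      sold_le_length[of "decisions A \<omega> a 2" 1]
    by (simp add: reward_delayed_bonus_instance del: decisions.simps)
  then show ?thesis
    unfolding expected_revenue_def
    by (intro integral_le_const[OF integrable_revenue[OF valid_delayed_bonus_instance[OF assms(1)] on]])
       (auto simp: space_pair_measure)
qed

lemma online_commit_algorithm: "online_algorithm I (commit_algorithm I i)"
  unfolding online_algorithm_def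
  by (auto simp: commit_algorithm_def prob_space_return split: if_splits)

text \<open>Each factor of the product distribution is a point mass at \<open>True\<close>, which
  determines the support on the horizon.\<close>

lemma AE_arrivals_sure:
  assumes "\<And>t. t \<in> {1..horizon I} \<Longrightarrow> arrival_prob I t = 1"
  shows "AE a in measure_pmf (arrivals I). \<forall>t\<in>{1..horizon I}. a t"
proof -
  have "bernoulli_pmf 1 = return_pmf True"
    by (rule pmf_eqI) (auto simp: pmf_eq_0_set_pmf split: split_indicator)
  then have "set_pmf (arrivals I) \<subseteq> {a. \<forall>t\<in>{1..horizon I}. a t}"
    using assms by (auto simp: arrivals_def set_Pi_pmf PiE_dflt_def)
  then show ?thesis by (auto simp: AE_measure_pmf_iff)
qed

lemma commit_revenue_ge:
  assumes "M \<ge> 0"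
  shows "M \<le> expected_revenue (delayed_bonus_instance M)
                 (commit_algorithm (delayed_bonus_instance M) 2)"
proof -
  let ?I = "delayed_bonus_instance M" and ?A = "commit_algorithm (delayed_bonus_instance M) 2"
  let ?N = "seed ?A \<Otimes>\<^sub>M measure_pmf (arrivals ?I)"
  note on = online_commit_algorithm[of ?I 2]
  interpret S: prob_space "seed ?A" using on by (simp add: online_algorithm_def)
  interpret P: pair_prob_space "seed ?A" "measure_pmf (arrivals ?I)" ..
  \<comment> \<open>Writing 2 as \<open>Suc (Suc 0)\<close> lets \<open>decisions\<close> unfold
    twice. It also rewrites the product index 2, so the reward formula is put in the same
    form.\<close>
  have rev: "reward ?I (decisions ?A \<omega> a 2) = M" if "\<forall>t\<in>{1..2}. a t" for \<omega> a
    using that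
    by (simp add: numeral_2_eq_2 commit_algorithm_def available_def sold_def
        reward_delayed_bonus_instance[unfolded numeral_2_eq_2])
  have AE: "AE a in measure_pmf (arrivals ?I). \<forall>t\<in>{1..2}. a t"
    using AE_arrivals_sure[of ?I] by simp
  have "AE x in ?N. M \<le> (\<lambda>(\<omega>, a). reward ?I (decisions ?A \<omega> a (horizon ?I))) x"
  proof (rule P.AE_pair_measure)
    show "{x \<in> space ?N. M \<le> (\<lambda>(\<omega>, a). reward ?I (decisions ?A \<omega> a (horizon ?I))) x} \<in> sets ?N"
      using measurable_revenue[OF on] by measurable
    show "AE \<omega> in seed ?A. AE a in measure_pmf (arrivals ?I).
        M \<le> (\<lambda>(\<omega>, a). reward ?I (decisions ?A \<omega> a (horizon ?I))) (\<omega>, a)"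
      using AE by (auto simp: rev simp del: decisions.simps elim!: eventually_mono)
  qed
  then show ?thesis
    unfolding expected_revenue_def
    by (rule P.integral_ge_const[OF
          integrable_revenue[OF valid_delayed_bonus_instance[OF assms] on]])
qed

text \<open>\<open>greedy\<close> picks an arbitrary greedy algorithm for each instance, so every
  tie-breaking rule is covered.\<close>

theorem proposition1:
  fixes greedy :: "alloc_instance \<Rightarrow> algorithm"
  assumes "\<And>I. valid_instance I \<Longrightarrow> myopic_greedy I (greedy I)"
  shows "\<not> (\<exists>c::real. c > 0 \<and>
           (\<forall>I. valid_instance I \<longrightarrow> expected_revenue I (greedy I) \<ge> c * opt_online I))"
proof
  assume "\<exists>c::real. c > 0 \<and>
           (\<forall>I. valid_instance I \<longrightarrow> expected_revenue I (greedy I) \<ge> c * opt_online I)"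
  then obtain c :: real where c: "c > 0"
    and ratio: "\<And>I. valid_instance I \<Longrightarrow> c * opt_online I \<le> expected_revenue I (greedy I)"
    by blast
  \<comment> \<open>This gives \<open>c * M = 3\<close>, above the bound 2 on the greedy
    revenue.\<close>
  define M where "M = 3 / c"
  let ?I = "delayed_bonus_instance M"
  have M: "M \<ge> 0" using c by (simp add: M_def)
  note valid = valid_delayed_bonus_instance[OF M]
  \<comment> \<open>A real supremum dominates its members only for a bounded set, hence the appeal
    to \<open>bdd_above_expected_revenue\<close>.\<close>
  have "M \<le> opt_online ?I"
    unfolding opt_online_def
    by (rule cSUP_upper2[OF bdd_above_expected_revenue[OF valid] _ commit_revenue_ge[OF M]])
       (simp add: online_commit_algorithm)
  then have "c * M \<le> c * opt_online ?I" using c by simp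
  also have "\<dots> \<le> 2" using ratio[OF valid] greedy_revenue_le[OF M assms[OF valid]] by simp
  finally show False using c by (simp add: M_def)
qed

end
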